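(* $\Sigma\Pi f\equiv_{\mathrm{sW}}(\Pi f)^{\mathcal D}$ for every problem $f$, where $\Pi f$ is the parallelization of $f$, $\Sigma$ denotes stashing, and $g^{\mathcal D}$ denotes the upper Turing cone version of a problem $g$.
   Context: A represented space is a set $X$ with a partial surjective map $\delta_X:\subseteq\mathbb N^{\mathbb N}\to X$. A problem is a partial multi-valued function $f:\subseteq X\rightrightarrows Y$ between represented spaces that has a realizer; a realizer of $f$ is a function $F:\subseteq\mathbb N^{\mathbb N}\to\mathbb N^{\mathbb N}$ with $\delta_YF(p)\in f\delta_X(p)$ for all $p\in\mathrm{dom}(f\delta_X)$. For problems $f,g$: $f\leq_{\mathrm{sW}}g$ if there are computable $H,K:\subseteq\mathbb N^{\mathbb N}\to\mathbb N^{\mathbb N}$ such that $HGK$ is a realizer of $f$ whenever $G$ is a realizer of $g$; $f\equiv_{\mathrm{sW}}g$ means $f\leq_{\mathrm{sW}}g$ and $g\leq_{\mathrm{sW}}f$. For a represented space $Y$, the completion $\overline Y:=Y\cup\{\bot\}$ ($\bot\notin Y$) is represented by the total map $\delta_{\overline Y}$ with $\delta_{\overline Y}(p)=\delta_Y(p-1)$ if $p-1\in\mathrm{dom}(\delta_Y)$ and $\delta_{\overline Y}(p)=\bot$ otherwise, where $p-1\in\mathbb N^{\mathbb N}\cup\mathbb N^*$ is the concatenation of $p(0)-1,p(1)-1,\dots$ and $0-1$ is the empty word. $X^{\mathbb N}$ is represented by $\langle p_0,p_1,\dots\rangle\mapsto(\delta_X(p_n))_n$, where $\langle p_0,p_1,\dots\rangle\langle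 n,k\rangle:=p_n(k)$ and $\langle n,k\rangle:=\frac12(n+k)(n+k+1)+k$ for $n,k\in\mathbb N$. For $f:\subseteq X\rightrightarrows Y$: the parallelization $\Pi f:\subseteq X^{\mathbb N}\rightrightarrows Y^{\mathbb N}$ (also written $\widehat f$) has domain $\mathrm{dom}(f)^{\mathbb N}$ and $\Pi f((x_n)_n)=\{(y_n)_n:(\forall n)\ y_n\in f(x_n)\}$; the stashing $\Sigma f:\subseteq X^{\mathbb N}\rightrightarrows\overline Y^{\mathbb N}$ has domain $\mathrm{dom}(f)^{\mathbb N}$ and $\Sigma f((x_n)_n)=\{(y_n)_n\in\overline Y^{\mathbb N}:(\exists n)\ y_n\in f(x_n)\}$. $\mathcal D$ is the set of Turing degrees $\deg_{\mathrm T}(p)=\{q\in\mathbb N^{\mathbb N}:q\equiv_{\mathrm T}p\}$, represented by $\delta_{\mathcal D}(p)=\deg_{\mathrm T}(p)$. For $y$ in a represented space $(Y,\delta_Y)$ and $q\in\mathbb N^{\mathbb N}$, $y\leq_{\mathrm T}q$ means that some name $p\in\delta_Y^{-1}\{y\}$ satisfies $p\leq_{\mathrm T}q$. The upper Turing cone version of $f:\subseteq X\rightrightarrows Y$ is $f^{\mathcal D}:\subseteq X\rightrightarrows\mathcal D$ with $\mathrm{dom}(f^{\mathcal D})=\mathrm{dom}(f)$ and $f^{\mathcal D}(x)=\{\deg_{\mathrm T}(q):(\exists y\leq_{\mathrm T}q)\ y\in f(x)\}$. *)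

theory Defs
  imports "HOL-Library.Infinite_Set" "HOL-Library.Nat_Bijection"
begin

type_synonym baire = "nat \<Rightarrow> nat"

definition cpair :: "nat \<Rightarrow> nat \<Rightarrow> nat" where
  "cpair n k = (n + k) * (n + k + 1) div 2 + k"

lemma cpair_eq_prod_encode: "cpair n k = prod_encode (k, n)"
  by (simp add: cpair_def prod_encode_def triangle_def add.commute mult.commute)

text \<open>
  Computability is that of the partial recursive functions relative to an oracle
  \<open>p :: baire\<close>. All functions are unary; several arguments are packed with \<open>cpair\<close>.
  The primitive-recursion scheme is \<open>h\<langle>x,0\<rangle> = f x\<close>, \<open>h\<langle>x,n+1\<rangle> = g\<langle>x,\<langle>n,h\<langle>x,n\<rangle>\<rangle>\<rangle>\<close>, and
  \<open>Mu f\<close> maps \<open>x\<close> to the least \<open>n\<close> with \<open>f\<langle>x,n\<rangle> = 0\<close>, requiring \<open>f\<langle>x,m\<rangle>\<close> to be defined for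
  all \<open>m < n\<close>. The oracle enters the evaluation but not the code, so one code defines
  a functional uniformly in the oracle.
\<close>

datatype code = Zero | Succ | Left | Right | Query
  | Pairing code code | Comp code code | Prec code code | Mu code

inductive evaluates :: "baire \<Rightarrow> code \<Rightarrow> nat \<Rightarrow> nat \<Rightarrow> bool" for p :: baire where
  "evaluates p Zero x 0"
| "evaluates p Succ x (Suc x)"
| "evaluates p Left (cpair x y) x"
| "evaluates p Right (cpair x y) y"
| "evaluates p Query x (p x)"
| "evaluates p f x y \<Longrightarrow> evaluates p g x z \<Longrightarrow> evaluates p (Pairing f g) x (cpair y z)"
| "evaluates p g x y \<Longrightarrow> evaluates p f y z \<Longrightarrow> evaluates p (Comp f g) x z"
| "evaluates p f x y \<Longrightarrow> evaluates p (Prec f g) (cpair x 0) y"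
| "evaluates p (Prec f g) (cpair x n) y \<Longrightarrow> evaluates p g (cpair x (cpair n y)) z \<Longrightarrow>
    evaluates p (Prec f g) (cpair x (Suc n)) z"
| "evaluates p f (cpair x n) 0 \<Longrightarrow> (\<And>m. m < n \<Longrightarrow> \<exists>v. evaluates p f (cpair x m) (Suc v)) \<Longrightarrow>
    evaluates p (Mu f) x n"

definition turing_le :: "baire \<Rightarrow> baire \<Rightarrow> bool"  (infix "\<le>\<^sub>T" 50) where
  "q \<le>\<^sub>T p \<longleftrightarrow> (\<exists>c. \<forall>n. evaluates p c n (q n))"

definition turing_eq :: "baire \<Rightarrow> baire \<Rightarrow> bool"  (infix "\<equiv>\<^sub>T" 50) where
  "q \<equiv>\<^sub>T p \<longleftrightarrow> q \<le>\<^sub>T p \<and> p \<le>\<^sub>T q"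

text \<open>As usual for partial functions on Baire space, nothing is required of the
  code on inputs outside the domain of \<open>F\<close>.\<close>

definition computable :: "(baire \<rightharpoonup> baire) \<Rightarrow> bool" where
  "computable F \<longleftrightarrow> (\<exists>c. \<forall>p q. F p = Some q \<longrightarrow> (\<forall>n. evaluates p c n (q n)))"

text \<open>A represented space is given by its representation \<open>\<delta>\<close>; since representations are
  surjective, the underlying set is \<open>ran \<delta>\<close>.\<close>

type_synonym 'a represented = "baire \<rightharpoonup> 'a"

text \<open>The values \<open>app f x\<close> are meaningful only for \<open>x \<in> pdom f\<close>.\<close>

record ('a, 'b) problem =
  src :: "'a represented"
  tgt :: "'b represented"
  pdom :: "'a set"
  app :: "'a \<Rightarrow> 'b set"

definition realizer :: "(baire \<rightharpoonup> baire) \<Rightarrow> ('a, 'b) problem \<Rightarrow> bool" where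
  "realizer F f \<longleftrightarrow> (\<forall>p x. src f p = Some x \<and> x \<in> pdom f \<longrightarrow>
     (\<exists>q y. F p = Some q \<and> tgt f q = Some y \<and> y \<in> app f x))"

definition is_problem :: "('a, 'b) problem \<Rightarrow> bool" where
  "is_problem f \<longleftrightarrow> pdom f \<subseteq> ran (src f) \<and> (\<forall>x\<in>pdom f. app f x \<subseteq> ran (tgt f)) \<and>
     (\<exists>F. realizer F f)"

definition sW_le :: "('a, 'b) problem \<Rightarrow> ('c, 'd) problem \<Rightarrow> bool"  (infix "\<le>\<^sub>s\<^sub>W" 50) where
  "f \<le>\<^sub>s\<^sub>W g \<longleftrightarrow> (\<exists>H K. computable H \<and> computable K \<and>
     (\<forall>G. realizer G g \<longrightarrow> realizer (H \<circ>\<^sub>m G \<circ>\<^sub>m K) f))"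

definition sW_eq :: "('a, 'b) problem \<Rightarrow> ('c, 'd) problem \<Rightarrow> bool"  (infix "\<equiv>\<^sub>s\<^sub>W" 50) where
  "f \<equiv>\<^sub>s\<^sub>W g \<longleftrightarrow> f \<le>\<^sub>s\<^sub>W g \<and> g \<le>\<^sub>s\<^sub>W f"

text \<open>The sequence \<open>p - 1\<close> obtained by deleting the zeros of \<open>p\<close> and decrementing the other
  entries. If only finitely many entries are nonzero, then \<open>p - 1\<close> is a finite word, hence never
  a name; all these words are collapsed to \<open>None\<close>.\<close>

definition minus_one :: "baire \<rightharpoonup> baire" where
  "minus_one p = (if infinite {i. p i \<noteq> 0}
     then Some (\<lambda>n. p (enumerate {i. p i \<noteq> 0} n) - 1) else None)"

text \<open>The completion of \<open>Y\<close> lives in the option type, with \<open>None\<close> as bottom; the outer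
  \<open>Some\<close> expresses that its representation is total.\<close>

definition completion :: "'a represented \<Rightarrow> 'a option represented" where
  "completion \<delta> p = Some (case minus_one p of None \<Rightarrow> None | Some q \<Rightarrow> \<delta> q)"

text \<open>Every point of Baire space is \<open>\<langle>p\<^sub>0,p\<^sub>1,\<dots>\<rangle>\<close> for a unique sequence, with
  \<open>p\<^sub>n = component p n\<close>.\<close>

definition component :: "baire \<Rightarrow> nat \<Rightarrow> baire" where
  "component p n = (\<lambda>k. p (cpair n k))"

definition seq_space :: "'a represented \<Rightarrow> (nat \<Rightarrow> 'a) represented" where
  "seq_space \<delta> p = (if \<forall>n. component p n \<in> dom \<delta>
     then Some (\<lambda>n. the (\<delta> (component p n))) else None)"

definition parallelization :: "('a, 'b) problem \<Rightarrow> (nat \<Rightarrow> 'a, nat \<Rightarrow> 'b) problem" where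
  "parallelization f = \<lparr> src = seq_space (src f), tgt = seq_space (tgt f),
     pdom = {x. \<forall>n. x n \<in> pdom f},
     app = (\<lambda>x. {y. \<forall>n. y n \<in> app f (x n)}) \<rparr>"

definition stashing :: "('a, 'b) problem \<Rightarrow> (nat \<Rightarrow> 'a, nat \<Rightarrow> 'b option) problem" where
  "stashing f = \<lparr> src = seq_space (src f), tgt = seq_space (completion (tgt f)),
     pdom = {x. \<forall>n. x n \<in> pdom f},
     app = (\<lambda>x. {y \<in> ran (seq_space (completion (tgt f))). \<exists>n. y n \<in> Some ` app f (x n)}) \<rparr>"

definition turing_degree :: "baire \<Rightarrow> baire set" where
  "turing_degree p = {q. q \<equiv>\<^sub>T p}"

definition degrees :: "baire set represented" where
  "degrees p = Some (turing_degree p)"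

definition point_turing_le :: "'a represented \<Rightarrow> 'a \<Rightarrow> baire \<Rightarrow> bool" where
  "point_turing_le \<delta> y q \<longleftrightarrow> (\<exists>p. \<delta> p = Some y \<and> p \<le>\<^sub>T q)"

definition upper_cone :: "('a, 'b) problem \<Rightarrow> ('a, baire set) problem" where
  "upper_cone f = \<lparr> src = src f, tgt = degrees, pdom = pdom f,
     app = (\<lambda>x. {turing_degree q | q. \<exists>y. point_turing_le (tgt f) y q \<and> y \<in> app f x}) \<rparr>"

end

theory Submission
  imports Defs
begin

text \<open>
  A name of a stashed solution computes a name of its correct component, which gives
  \<open>g\<^sup>\<D> \<le>\<^sub>s\<^sub>W \<Sigma>g\<close> for every problem \<open>g\<close>, with the constant sequence as instance.
  Conversely, given instances \<open>(x\<^sub>n)\<^sub>n\<close> of \<open>\<Pi>f\<close>, merge them into a single instance of \<open>\<Pi>f\<close>.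
  If \<open>q\<close> computes a solution, then it does so by some program \<open>n\<close>. Run every program \<open>n\<close> on \<open>q\<close>,
  writing zeros while waiting, to produce its \<open>n\<close>-th block of the merged solution as a name in the
  completion; the correct program then solves \<open>x\<^sub>n\<close>. Running programs step by step requires
  a universal machine as a code.
\<close>

section \<open>Projections of the pairing function\<close>

definition cfst :: "nat \<Rightarrow> nat" where "cfst z = snd (prod_decode z)"
definition csnd :: "nat \<Rightarrow> nat" where "csnd z = fst (prod_decode z)"

lemma cfst_cpair [simp]: "cfst (cpair a b) = a"
  by (simp add: cfst_def cpair_eq_prod_encode)

lemma csnd_cpair [simp]: "csnd (cpair a b) = b"
  by (simp add: csnd_def cpair_eq_prod_encode)

lemma cpair_cfst_csnd [simp]: "cpair (cfst z) (csnd z) = z"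
  by (simp add: cfst_def csnd_def cpair_eq_prod_encode)

section \<open>Computability relative to a set of oracles\<close>

text \<open>For \<open>A = UNIV\<close> this is uniform computability, for \<open>A = {p}\<close> Turing reducibility to \<open>p\<close>.\<close>

definition computes :: "baire set \<Rightarrow> (baire \<Rightarrow> nat \<Rightarrow> nat) \<Rightarrow> bool" where
  "computes A F \<longleftrightarrow> (\<exists>c. \<forall>p\<in>A. \<forall>x. evaluates p c x (F p x))"

lemma computes_imp_turing_le:
  assumes "computes {p} F"
  shows "F p \<le>\<^sub>T p"
  using assms by (simp add: turing_le_def computes_def)

lemma computable_total:
  assumes "computes UNIV h"
  shows "computable (\<lambda>p. Some (h p))"
  using assms by (auto simp: computable_def computes_def)

lemma computes_compose:
  assumes "computes A g" "computes A f"
  shows "computes A (\<lambda>p x. g p (f p x))"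
  using assms unfolding computes_def by (meson evaluates.intros(7))

lemma computes_cpair:
  assumes "computes A f" "computes A g"
  shows "computes A (\<lambda>p x. cpair (f p x) (g p x))"
  using assms unfolding computes_def by (meson evaluates.intros(6))

lemma computes_cfst:
  assumes "computes A f"
  shows "computes A (\<lambda>p x. cfst (f p x))"
proof (rule computes_compose [OF _ assms])
  show "computes A (\<lambda>p. cfst)"
    unfolding computes_def by (metis evaluates.intros(3) cpair_cfst_csnd)
qed

lemma computes_csnd:
  assumes "computes A f"
  shows "computes A (\<lambda>p x. csnd (f p x))"
proof (rule computes_compose [OF _ assms])
  show "computes A (\<lambda>p. csnd)"
    unfolding computes_def by (metis evaluates.intros(4) cpair_cfst_csnd)
qed

text \<open>Pairing is surjective, so the identity arises by pairing the codes \<open>Left\<close>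
  and \<open>Right\<close>.\<close>

lemma computes_id: "computes A (\<lambda>p x. x)"
  unfolding computes_def by (metis evaluates.intros(3,4,6) cpair_cfst_csnd)

lemma computes_Suc:
  assumes "computes A f"
  shows "computes A (\<lambda>p x. Suc (f p x))"
  by (rule computes_compose [OF _ assms]) (auto simp: computes_def intro: evaluates.intros)

lemma computes_query:
  assumes "computes A f"
  shows "computes A (\<lambda>p x. p (f p x))"
  by (rule computes_compose [OF _ assms]) (auto simp: computes_def intro: evaluates.intros)

lemma computes_const: "computes A (\<lambda>p x. k)"
proof (induction k)
  case 0
  show ?case by (auto simp: computes_def intro: evaluates.intros)
next
  case (Suc k)
  then show ?case by (rule computes_Suc)
qed

lemma computes_rec_nat:
  assumes "computes A a" and "computes A (\<lambda>p z. b p (cfst z) (cfst (csnd z)) (csnd (csnd z)))"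
    and "computes A n"
  shows "computes A (\<lambda>p x. rec_nat (a p x) (b p x) (n p x))"
proof -
  obtain ca where ca: "evaluates p ca x (a p x)" if "p \<in> A" for p x
    using assms(1) by (auto simp: computes_def)
  obtain cb where cb: "evaluates p cb z (b p (cfst z) (cfst (csnd z)) (csnd (csnd z)))"
    if "p \<in> A" for p z
    using assms(2) by (auto simp: computes_def)
  have "evaluates p (Prec ca cb) (cpair x m) (rec_nat (a p x) (b p x) m)" if "p \<in> A" for p x m
  proof (induction m)
    case 0
    show ?case using ca [OF that] by (auto intro: evaluates.intros)
  next
    case (Suc m)
    then show ?case
      using cb [OF that, of "cpair x (cpair m (rec_nat (a p x) (b p x) m))"]
      by (auto intro: evaluates.intros)
  qed
  then have "evaluates p (Prec ca cb) z (rec_nat (a p (cfst z)) (b p (cfst z)) (csnd z))"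
    if "p \<in> A" for p z
    using that by (metis cpair_cfst_csnd)
  then have "computes A (\<lambda>p z. rec_nat (a p (cfst z)) (b p (cfst z)) (csnd z))"
    unfolding computes_def by blast
  from computes_compose [OF this computes_cpair [OF computes_id assms(3)]] show ?thesis
    by simp
qed

lemmas computes_basic = computes_cpair computes_cfst computes_csnd computes_id computes_Suc
  computes_query computes_const

section \<open>Iteration, case distinction and decidable predicates\<close>

lemma computes_funpow:
  assumes "computes A g" "computes A n" "computes A s"
  shows "computes A (\<lambda>p x. (g p ^^ n p x) (s p x))"
proof -
  have "rec_nat y (\<lambda>_. h) k = (h ^^ k) y" for h :: "nat \<Rightarrow> nat" and k y
    by (induction k) auto
  moreover have "computes A (\<lambda>p x. rec_nat (s p x) (\<lambda>_ y. g p y) (n p x))"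
    by (intro computes_rec_nat computes_compose [OF assms(1)] assms computes_basic)
  ultimately show ?thesis by simp
qed

lemma computes_diff:
  assumes "computes A f" "computes A g"
  shows "computes A (\<lambda>p x. f p x - g p x)"
proof -
  have "rec_nat 0 (\<lambda>m _. m) k = k - 1" for k :: nat
    by (cases k) auto
  moreover have "computes A (\<lambda>p x. rec_nat 0 (\<lambda>m _. m) x)"
    by (intro computes_rec_nat computes_basic)
  ultimately have pred: "computes A (\<lambda>p x. x - 1)"
    by simp
  have "rec_nat k (\<lambda>_ y. y - 1) m = k - m" for k m :: nat
    by (induction m) auto
  moreover have "computes A (\<lambda>p x. rec_nat (f p x) (\<lambda>_ y. y - 1) (g p x))"
    by (intro computes_rec_nat computes_compose [OF pred] assms computes_basic)
  ultimately show ?thesis by simp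
qed

text \<open>The truth value is the number of recursion steps: none leaves the \<open>else\<close>
  value, one replaces it by the \<open>then\<close> value.\<close>

lemma computes_if:
  assumes "computes A (\<lambda>p x. of_bool (P p x))" "computes A f" "computes A g"
  shows "computes A (\<lambda>p x. if P p x then f p x else g p x)"
proof -
  have "(if P p x then f p x else g p x) = rec_nat (g p x) (\<lambda>_ _. f p x) (of_bool (P p x))" for p x
    by simp
  moreover have "computes A (\<lambda>p x. rec_nat (g p x) (\<lambda>_ _. f p x) (of_bool (P p x)))"
    by (intro computes_rec_nat computes_compose [OF assms(2)] assms computes_basic)
  ultimately show ?thesis by simp
qed

lemma computes_le:
  assumes "computes A f" "computes A g"
  shows "computes A (\<lambda>p x. of_bool (f p x \<le> g p x))"
proof -
  have "of_bool (f p x \<le> g p x) = 1 - (f p x - g p x)" for p x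
    by simp
  then show ?thesis
    by (simp only:) (intro computes_diff assms computes_basic)
qed

lemma computes_conj:
  assumes "computes A (\<lambda>p x. of_bool (P p x))" "computes A (\<lambda>p x. of_bool (Q p x))"
  shows "computes A (\<lambda>p x. of_bool (P p x \<and> Q p x))"
proof -
  have "(of_bool (P p x \<and> Q p x) :: nat) = (if P p x then of_bool (Q p x) else 0)" for p x
    by simp
  then show ?thesis
    by (simp only:) (intro computes_if assms computes_basic)
qed

lemma computes_not:
  assumes "computes A (\<lambda>p x. of_bool (P p x))"
  shows "computes A (\<lambda>p x. of_bool (\<not> P p x))"
proof -
  have "(of_bool (\<not> P p x) :: nat) = 1 - of_bool (P p x)" for p x
    by simp
  then show ?thesis
    by (simp only:) (intro computes_diff assms computes_basic)
qed

lemma computes_eq: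
  assumes "computes A f" "computes A g"
  shows "computes A (\<lambda>p x. of_bool (f p x = g p x))"
  unfolding order_eq_iff by (intro computes_conj computes_le assms)

lemmas computes_intros = computes_basic computes_diff computes_if computes_le computes_conj
  computes_not computes_eq

text \<open>\<open>Mu\<close> looks for a zero, so truth is coded as \<open>1 - of_bool\<close>. The
  search must succeed for oracles in \<open>A\<close> only, so \<open>A = {p}\<close> covers a
  search that succeeds for one given oracle.\<close>

lemma computes_Least:
  assumes "computes A (\<lambda>p z. of_bool (P p (cfst z) (csnd z)))"
    and "\<And>p x. p \<in> A \<Longrightarrow> \<exists>n. P p x n"
  shows "computes A (\<lambda>p x. LEAST n. P p x n)"
proof -
  have "computes A (\<lambda>p z. 1 - of_bool (P p (cfst z) (csnd z)))"
    by (intro computes_diff computes_const assms(1))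
  then obtain c where c: "evaluates p c z (1 - of_bool (P p (cfst z) (csnd z)))"
    if "p \<in> A" for p z
    unfolding computes_def by blast
  have "evaluates p (Mu c) x (LEAST n. P p x n)" if "p \<in> A" for p x
  proof (rule evaluates.intros(10))
    have "P p x (LEAST n. P p x n)"
      using assms(2) [OF that] by (rule LeastI_ex)
    then show "evaluates p c (cpair x (LEAST n. P p x n)) 0"
      using c [OF that, of "cpair x (LEAST n. P p x n)"] by simp
  next
    fix m
    assume "m < (LEAST n. P p x n)"
    then have "\<not> P p x m" by (rule not_less_Least)
    then show "\<exists>v. evaluates p c (cpair x m) (Suc v)"
      using c [OF that, of "cpair x m"] by auto
  qed
  then show ?thesis
    unfolding computes_def by blast
qed

section \<open>Turing reducibility\<close>

lemma turing_le_refl: "p \<le>\<^sub>T p"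
  using computes_imp_turing_le [OF computes_query [OF computes_id]] .

text \<open>Transitivity of Turing reducibility: each oracle query is replaced by a program
  computing the answer.\<close>

primrec subst_query :: "code \<Rightarrow> code \<Rightarrow> code" where
  "subst_query d Zero = Zero"
| "subst_query d Succ = Succ"
| "subst_query d Left = Left"
| "subst_query d Right = Right"
| "subst_query d Query = d"
| "subst_query d (Pairing f g) = Pairing (subst_query d f) (subst_query d g)"
| "subst_query d (Comp f g) = Comp (subst_query d f) (subst_query d g)"
| "subst_query d (Prec f g) = Prec (subst_query d f) (subst_query d g)"
| "subst_query d (Mu f) = Mu (subst_query d f)"

lemma evaluates_subst_query:
  assumes "evaluates q c x y" and d: "\<And>n. evaluates p d n (q n)"
  shows "evaluates p (subst_query d c) x y"
  using assms(1)
proof (induction rule: evaluates.induct)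
  case (10 f x n)
  then show ?case by (auto intro!: evaluates.intros(10))
qed (auto intro: evaluates.intros d)

lemma turing_le_trans:
  assumes "r \<le>\<^sub>T q" "q \<le>\<^sub>T p"
  shows "r \<le>\<^sub>T p"
  using assms unfolding turing_le_def by (meson evaluates_subst_query)

lemma component_turing_le: "component p n \<le>\<^sub>T p"
proof -
  have "computes {p} (\<lambda>p k. p (cpair n k))"
    by (intro computes_intros)
  from computes_imp_turing_le [OF this] show ?thesis
    by (simp add: component_def)
qed

lemma minus_one_turing_le:
  assumes "minus_one p = Some r"
  shows "r \<le>\<^sub>T p"
proof -
  let ?S = "{i. p i \<noteq> 0}"
  define next_pos where "next_pos = (\<lambda>q y. LEAST i :: nat. q i \<noteq> (0 :: nat) \<and> y \<le> i)"
  have inf: "infinite ?S" and r: "r = (\<lambda>n. p (enumerate ?S n) - 1)"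
    using assms by (auto simp: minus_one_def split: if_splits)
  have next_pos: "computes {p} next_pos"
    unfolding next_pos_def
  proof (rule computes_Least)
    show "computes {p} (\<lambda>q z. of_bool (q (csnd z) \<noteq> 0 \<and> cfst z \<le> csnd z))"
      by (intro computes_intros)
    show "\<exists>i. q i \<noteq> 0 \<and> y \<le> i" if "q \<in> {p}" for q y
      using inf that unfolding infinite_nat_iff_unbounded_le by auto
  qed
  \<comment> \<open>The bound in \<open>next_pos\<close> is not strict: \<open>0\<close> starts the
    search and \<open>Suc y\<close> moves past the position found last.\<close>
  have enum: "enumerate ?S n = rec_nat (next_pos p 0) (\<lambda>_ y. next_pos p (Suc y)) n" for n
  proof (induction n)
    case 0
    show ?case by (simp add: enumerate_0 next_pos_def)
  next
    case (Suc n)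
    have "enumerate ?S (Suc n) = (LEAST i. i \<in> ?S \<and> enumerate ?S n < i)"
      by (rule enumerate_Suc'' [OF inf])
    with Suc show ?case by (simp add: next_pos_def Suc_le_eq)
  qed
  have "computes {p} (\<lambda>q n. q (rec_nat (next_pos q 0) (\<lambda>_ y. next_pos q (Suc y)) n) - 1)"
    by (intro computes_diff computes_query computes_rec_nat computes_compose [OF next_pos]
        computes_basic)
  from computes_imp_turing_le [OF this] show ?thesis
    by (simp only: r enum)
qed

section \<open>A step-bounded universal machine\<close>

text \<open>A configuration \<open>cpair K v\<close> consists of a stack \<open>K\<close> of instructions, the empty stack
  being \<open>0\<close>, and a current value \<open>v\<close>. Instructions are pairs of a tag and an argument: tags up
  to 8 are codes, and the remaining ones are the continuations needed while subcodes run.\<close>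

definition push :: "nat \<Rightarrow> nat \<Rightarrow> nat" where
  "push i K = Suc (cpair i K)"

primrec encode :: "code \<Rightarrow> nat" where
  "encode Zero = cpair 0 0"
| "encode Succ = cpair 1 0"
| "encode Left = cpair 2 0"
| "encode Right = cpair 3 0"
| "encode Query = cpair 4 0"
| "encode (Pairing f g) = cpair 5 (cpair (encode f) (encode g))"
| "encode (Comp f g) = cpair 6 (cpair (encode f) (encode g))"
| "encode (Prec f g) = cpair 7 (cpair (encode f) (encode g))"
| "encode (Mu f) = cpair 8 (encode f)"

abbreviation prefix_instr :: "nat \<Rightarrow> nat" where
  "prefix_instr a \<equiv> cpair 9 a"
abbreviation second_instr :: "nat \<Rightarrow> nat \<Rightarrow> nat" where
  "second_instr g x \<equiv> cpair 10 (cpair g x)"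
abbreviation search_instr :: "nat \<Rightarrow> nat \<Rightarrow> nat \<Rightarrow> nat" where
  "search_instr f x n \<equiv> cpair 11 (cpair f (cpair x n))"

text \<open>\<open>prefix_instr\<close> pairs a saved number with the current value,
  \<open>second_instr\<close> saves the first result and starts the second subcode, and
  \<open>search_instr\<close> tests a candidate and either stops or tries the next one.\<close>

definition execute :: "baire \<Rightarrow> nat \<Rightarrow> nat \<Rightarrow> nat \<Rightarrow> nat \<Rightarrow> nat" where
  "execute p t d K v =
    (if t = 0 then cpair K 0
     else if t = 1 then cpair K (Suc v)
     else if t = 2 then cpair K (cfst v)
     else if t = 3 then cpair K (csnd v)
     else if t = 4 then cpair K (p v)
     else if t = 5 then cpair (push (cfst d) (push (second_instr (csnd d) v) K)) v
     else if t = 6 then cpair (push (csnd d) (push (cfst d) K)) v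
     else if t = 7 then
       if csnd v = 0 then cpair (push (cfst d) K) (cfst v)
       else cpair (push (cpair t d) (push (prefix_instr (csnd v - 1))
         (push (prefix_instr (cfst v)) (push (csnd d) K)))) (cpair (cfst v) (csnd v - 1))
     else if t = 8 then cpair (push d (push (search_instr d v 0) K)) (cpair v 0)
     else if t = 9 then cpair K (cpair d v)
     else if t = 10 then cpair (push (cfst d) (push (prefix_instr v) K)) (csnd d)
     else if v = 0 then cpair K (csnd (csnd d))
     else cpair (push (cfst d) (push (search_instr (cfst d) (cfst (csnd d)) (Suc (csnd (csnd d)))) K))
       (cpair (cfst (csnd d)) (Suc (csnd (csnd d)))))"

definition step :: "baire \<Rightarrow> nat \<Rightarrow> nat" where
  "step p s = (if cfst s = 0 then s
     else execute p (cfst (cfst (cfst s - 1))) (csnd (cfst (cfst s - 1)))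
       (csnd (cfst s - 1)) (csnd s))"

lemma step_halted: "cfst s = 0 \<Longrightarrow> step p s = s"
  by (simp add: step_def)

lemma step_push: "step p (cpair (push (cpair t d) K) v) = execute p t d K v"
  by (simp add: step_def push_def)

lemma computes_step: "computes A step"
proof -
  have "computes A (\<lambda>p s. step p s)"
    unfolding step_def execute_def push_def by (intro computes_intros)
  then show ?thesis by simp
qed

section \<open>Runs of the machine and their correctness\<close>

definition reaches :: "baire \<Rightarrow> nat \<Rightarrow> nat \<Rightarrow> bool" where
  "reaches p s s' \<longleftrightarrow> (\<exists>t. (step p ^^ t) s = s')"

lemma reaches_refl: "reaches p s s"
  unfolding reaches_def by (metis funpow_0)

lemma reaches_trans:
  assumes "reaches p s s'" "reaches p s' s''"
  shows "reaches p s s''"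
  using assms unfolding reaches_def by (metis funpow_add o_apply)

lemma reaches_step:
  assumes "reaches p (execute p t d K v) s"
  shows "reaches p (cpair (push (cpair t d) K) v) s"
  using assms unfolding reaches_def step_push [symmetric] by (metis funpow_Suc_right o_apply)

text \<open>Induction on the evaluation, with \<open>K\<close> arbitrary because a subcode runs on
  top of the continuations pushed for it.\<close>

lemma reaches_encode:
  assumes "evaluates p c x y"
  shows "reaches p (cpair (push (encode c) K) x) (cpair K y)"
  using assms
proof (induction arbitrary: K rule: evaluates.induct)
  case (6 f x y g z)
  have "reaches p (cpair (push (second_instr (encode g) x) K) y) (cpair K (cpair y z))"
    by (rule reaches_step, simp add: execute_def)
      (rule reaches_trans [OF 6(4)], rule reaches_step, simp add: execute_def reaches_refl)
  from reaches_trans [OF 6(3) this] show ?case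
    by (simp add: reaches_step execute_def)
next
  case (7 g x y f z)
  from reaches_trans [OF 7(3) 7(4)] show ?case
    by (simp add: reaches_step execute_def)
next
  case (8 f x y g)
  then show ?case
    by (simp add: reaches_step execute_def)
next
  case (9 f g x n y z)
  \<comment> \<open>The two prefixes rebuild the argument \<open>cpair x (cpair n y)\<close> of the
    step code from the recursive result \<open>y\<close>.\<close>
  have "reaches p (cpair (push (prefix_instr n) (push (prefix_instr x) (push (encode g) K))) y)
      (cpair K z)"
    by (rule reaches_step, simp add: execute_def, rule reaches_step, simp add: execute_def 9(4))
  from reaches_trans [OF 9(3) this] show ?case
    by (simp add: reaches_step execute_def)
next
  case (10 f x n)
  \<comment> \<open>Backward induction from the successful test: \<open>k\<close> is the distance to
    \<open>n\<close>, and \<open>k = n\<close> is the start of the search at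
    \<open>0\<close>.\<close>
  have "reaches p (cpair (push (encode f) (push (search_instr (encode f) x (n - k)) K))
      (cpair x (n - k))) (cpair K n)" if "k \<le> n" for k
    using that
  proof (induction k)
    case 0
    show ?case
      unfolding diff_zero
      by (rule reaches_trans [OF 10(2)]) (rule reaches_step, simp add: execute_def reaches_refl)
  next
    case (Suc k)
    then have less: "n - Suc k < n" and Suc_eq: "Suc (n - Suc k) = n - k" by auto
    obtain v where "reaches p (cpair (push (encode f) K) (cpair x (n - Suc k))) (cpair K (Suc v))" for K
      using 10(3) [OF less] by blast
    then show ?case
      by (rule reaches_trans) (rule reaches_step, use Suc in \<open>simp add: execute_def Suc_eq\<close>)
  qed
  from this [of n] show ?case
    by (simp add: reaches_step execute_def)
qed (simp_all add: reaches_step execute_def reaches_refl)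

lemma funpow_step_halted:
  assumes "cfst ((step p ^^ t) s) = 0"
  shows "(step p ^^ (k + t)) s = (step p ^^ t) s"
  by (induction k) (simp_all add: assms step_halted)

text \<open>Prolonging both runs to \<open>t + t'\<close> steps changes neither result.\<close>

lemma halted_unique:
  assumes "cfst ((step p ^^ t) s) = 0" "cfst ((step p ^^ t') s) = 0"
  shows "(step p ^^ t) s = (step p ^^ t') s"
  using funpow_step_halted [OF assms(1), of t'] funpow_step_halted [OF assms(2), of t]
  by (simp add: add.commute)

section \<open>Enumerating all reducible points in the completion\<close>

lemma card_below_enumerate:
  fixes S :: "nat set"
  assumes "infinite S"
  shows "card {i. i < enumerate S n \<and> i \<in> S} = n"
proof -
  have "{i. i < enumerate S n \<and> i \<in> S} = enumerate S ` {..<n}"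
    using assms by (auto simp: enumerate_in_set) (metis enumerate_Ex enumerate_mono_iff imageI lessThan_iff)
  then show ?thesis
    by (simp add: card_image strict_mono_enumerate [OF assms, THEN strict_mono_imp_inj_on] inj_on_subset)
qed

text \<open>The \<open>n\<close>-th nonzero position has exactly \<open>n\<close> nonzero positions
  before it, so counting can replace \<open>enumerate\<close>.\<close>

lemma minus_one_eqI:
  assumes inf: "infinite {i. h i \<noteq> 0}"
    and val: "\<And>m. h m \<noteq> 0 \<Longrightarrow> h m = Suc (g (card {i. i < m \<and> h i \<noteq> 0}))"
  shows "minus_one h = Some g"
proof -
  have "h (enumerate {i. h i \<noteq> 0} n) = Suc (g n)" for n
  proof -
    have "h (enumerate {i. h i \<noteq> 0} n) \<noteq> 0"
      using enumerate_in_set [OF inf] by blast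
    from val [OF this] show ?thesis
      using card_below_enumerate [OF inf, of n] by (simp only: mem_Collect_eq)
  qed
  with inf show ?thesis
    by (simp add: minus_one_def)
qed

text \<open>The emitter state \<open>cpair n (cpair j s)\<close> consists of a program \<open>n\<close>, the number \<open>j\<close> of values
  produced so far and the configuration \<open>s\<close> of the run of \<open>n\<close> on input \<open>cpair n j\<close>.\<close>

definition initial :: "nat \<Rightarrow> nat \<Rightarrow> nat" where
  "initial n j = cpair (push n 0) (cpair n j)"

definition emit_step :: "baire \<Rightarrow> nat \<Rightarrow> nat" where
  "emit_step p z = (if cfst (csnd (csnd z)) = 0
     then cpair (cfst z) (cpair (Suc (cfst (csnd z))) (initial (cfst z) (Suc (cfst (csnd z)))))
     else cpair (cfst z) (cpair (cfst (csnd z)) (step p (csnd (csnd z)))))"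

definition emit_state :: "baire \<Rightarrow> nat \<Rightarrow> nat \<Rightarrow> nat" where
  "emit_state p n m = (emit_step p ^^ m) (cpair n (cpair 0 (initial n 0)))"

text \<open>Each result is written once, because the emitter leaves a halted run at its next step.
  Waiting writes zeros, so the output is total even when a program diverges.\<close>

definition emit :: "baire \<Rightarrow> baire" where
  "emit p x = (if cfst (csnd (csnd (emit_state p (cfst x) (csnd x)))) = 0
     then Suc (csnd (csnd (csnd (emit_state p (cfst x) (csnd x))))) else 0)"

lemma computes_emit: "computes A emit"
proof -
  have "computes A (\<lambda>p z. emit_step p z)"
    unfolding emit_step_def initial_def push_def
    by (intro computes_intros computes_compose [OF computes_step])
  then have emit_step: "computes A emit_step"
    by simp
  have "computes A (\<lambda>p x. emit p x)"
    unfolding emit_def emit_state_def initial_def push_def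
    by (intro computes_intros computes_funpow emit_step)
  then show ?thesis by simp
qed

text \<open>Program \<open>n\<close> only has to be evaluated on the inputs \<open>cpair n j\<close>, so component \<open>n\<close> of the
  output can depend on \<open>n\<close>.\<close>

lemma minus_one_component_emit:
  assumes "r \<le>\<^sub>T p"
  obtains n where "minus_one (component (emit p) n) = Some (component r n)"
proof -
  obtain c where c: "\<And>x. evaluates p c x (r x)"
    using assms by (auto simp: turing_le_def)
  define n where "n = encode c"
  define h where "h = component (emit p) n"
  define count where "count m = card {i. i < m \<and> h i \<noteq> 0}" for m
  have halts: "\<exists>t. (step p ^^ t) (initial n j) = cpair 0 (component r n j)" for j
    using reaches_encode [OF c] by (simp add: reaches_def initial_def n_def component_def)
  have h_state: "h m = (if cfst s = 0 then Suc (csnd s) else 0)"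
    if "emit_state p n m = cpair n (cpair j s)" for m j s
    using that by (simp add: h_def component_def emit_def)
  have count_Suc: "count (Suc m) = (if h m = 0 then count m else Suc (count m))" for m
  proof -
    have "{i. i < Suc m \<and> h i \<noteq> 0}
        = (if h m = 0 then {i. i < m \<and> h i \<noteq> 0} else insert m {i. i < m \<and> h i \<noteq> 0})"
      by (auto simp: less_Suc_eq)
    then show ?thesis by (simp add: count_def)
  qed
  have emit_state_Suc: "emit_state p n (Suc m) = emit_step p (emit_state p n m)" for m
    by (simp add: emit_state_def)
  \<comment> \<open>Invariant: the emitter's counter is the number of nonzero entries written so
    far.\<close>
  have state: "\<exists>t. emit_state p n m = cpair n (cpair (count m) ((step p ^^ t) (initial n (count m))))"
    for m
  proof (induction m)
    case 0
    have "emit_state p n 0 = cpair n (cpair (count 0) ((step p ^^ 0) (initial n (count 0))))"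
      by (simp add: emit_state_def count_def)
    then show ?case ..
  next
    case (Suc m)
    then obtain t where t: "emit_state p n m
      = cpair n (cpair (count m) ((step p ^^ t) (initial n (count m))))" ..
    show ?case
    proof (cases "cfst ((step p ^^ t) (initial n (count m))) = 0")
      case True
      then have "emit_state p n (Suc m)
          = cpair n (cpair (count (Suc m)) ((step p ^^ 0) (initial n (count (Suc m)))))"
        by (simp add: emit_state_Suc t emit_step_def count_Suc h_state [OF t])
      then show ?thesis ..
    next
      case False
      then have "emit_state p n (Suc m)
          = cpair n (cpair (count (Suc m)) ((step p ^^ Suc t) (initial n (count (Suc m)))))"
        by (simp add: emit_state_Suc t emit_step_def count_Suc h_state [OF t])
      then show ?thesis ..
    qed
  qed
  have "minus_one h = Some (component r n)"
  proof (rule minus_one_eqI)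
    show "infinite {i. h i \<noteq> 0}"
      unfolding infinite_nat_iff_unbounded_le
    proof (rule allI, rule ccontr)
      fix m
      assume "\<nexists>i. m \<le> i \<and> i \<in> {i. h i \<noteq> 0}"
      then have zero: "h (m + k) = 0" for k
        by simp
      obtain t where t: "emit_state p n m
          = cpair n (cpair (count m) ((step p ^^ t) (initial n (count m))))"
        using state by blast
      \<comment> \<open>Without output after \<open>m\<close> the same run goes on forever, although
        it has to halt.\<close>
      have run: "emit_state p n (m + k)
          = cpair n (cpair (count m) ((step p ^^ (k + t)) (initial n (count m))))" for k
      proof (induction k)
        case 0
        show ?case using t by simp
      next
        case (Suc k)
        have "cfst ((step p ^^ (k + t)) (initial n (count m))) \<noteq> 0"
          using h_state [OF Suc] zero [of k] by (auto split: if_splits)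
        then show ?case
          by (simp add: emit_state_Suc Suc emit_step_def)
      qed
      obtain T where T: "(step p ^^ T) (initial n (count m)) = cpair 0 (component r n (count m))"
        using halts by blast
      then have "(step p ^^ (t + T)) (initial n (count m)) = cpair 0 (component r n (count m))"
        using funpow_step_halted [where t = T and k = t and s = "initial n (count m)"] by simp
      then show False
        using h_state [OF run [of T]] zero [of T] by (simp add: add.commute)
    qed
  next
    fix m
    assume nz: "h m \<noteq> 0"
    obtain t where t: "emit_state p n m
        = cpair n (cpair (count m) ((step p ^^ t) (initial n (count m))))"
      using state by blast
    then have halted: "cfst ((step p ^^ t) (initial n (count m))) = 0"
      using h_state [OF t] nz by (auto split: if_splits)
    obtain T where "(step p ^^ T) (initial n (count m)) = cpair 0 (component r n (count m))"
      using halts by blast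
    with halted_unique [OF halted, of T] h_state [OF t] halted
    show "h m = Suc (component r n (card {i. i < m \<and> h i \<noteq> 0}))"
      by (simp add: count_def)
  qed
  then show thesis
    using that by (simp add: h_def)
qed

section \<open>The two reductions\<close>

lemma seq_space_eq_Some_iff:
  "seq_space \<delta> p = Some x \<longleftrightarrow> (\<forall>n. \<delta> (component p n) = Some (x n))"
proof
  assume "seq_space \<delta> p = Some x"
  then have "\<forall>n. component p n \<in> dom \<delta>" and "x = (\<lambda>n. the (\<delta> (component p n)))"
    by (auto simp: seq_space_def split: if_splits)
  then show "\<forall>n. \<delta> (component p n) = Some (x n)"
    by (simp add: domIff)
qed (auto simp: seq_space_def)

lemma completion_eq_Some_Some_iff:
  "completion \<delta> p = Some (Some y) \<longleftrightarrow> (\<exists>q. minus_one p = Some q \<and> \<delta> q = Some y)"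
  by (auto simp: completion_def split: option.splits)

text \<open>Which component is correct need not be known: the degree of the whole name
  \<open>q\<close> lies in the cone as soon as some component works, so the outer functional is the
  identity.\<close>

lemma upper_cone_le_stashing: "upper_cone f \<le>\<^sub>s\<^sub>W stashing f"
  unfolding sW_le_def
proof (intro exI conjI allI impI)
  show "computable (\<lambda>p. Some (\<lambda>n. p n))" "computable (\<lambda>p. Some (\<lambda>x. p (csnd x)))"
    by (intro computable_total computes_intros)+
  fix G
  assume G: "realizer G (stashing f)"
  show "realizer ((\<lambda>p. Some (\<lambda>n. p n)) \<circ>\<^sub>m G \<circ>\<^sub>m (\<lambda>p. Some (\<lambda>x. p (csnd x)))) (upper_cone f)"
    unfolding realizer_def
  proof (intro allI impI)
    fix p x
    assume "src (upper_cone f) p = Some x \<and> x \<in> pdom (upper_cone f)"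
    then have p: "src f p = Some x" "x \<in> pdom f"
      by (auto simp: upper_cone_def)
    have "component (\<lambda>m. p (csnd m)) n = p" for n
      by (simp add: component_def)
    then have "seq_space (src f) (\<lambda>m. p (csnd m)) = Some (\<lambda>_. x)"
      by (simp add: seq_space_eq_Some_iff p)
    then obtain q z where q: "G (\<lambda>m. p (csnd m)) = Some q" "seq_space (completion (tgt f)) q = Some z"
      and "\<exists>n. z n \<in> Some ` app f x"
      using G p(2) unfolding realizer_def stashing_def by fastforce
    then obtain n y where y: "z n = Some y" "y \<in> app f x" by auto
    then have "completion (tgt f) (component q n) = Some (Some y)"
      using q(2) by (simp add: seq_space_eq_Some_iff)
    then obtain r where r: "minus_one (component q n) = Some r" "tgt f r = Some y"
      by (auto simp: completion_eq_Some_Some_iff)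
    then have "point_turing_le (tgt f) y q"
      unfolding point_turing_le_def
      using turing_le_trans [OF minus_one_turing_le component_turing_le] by blast
    then show "\<exists>q' d. ((\<lambda>p. Some (\<lambda>n. p n)) \<circ>\<^sub>m G \<circ>\<^sub>m (\<lambda>p. Some (\<lambda>x. p (csnd x)))) p = Some q' \<and>
        tgt (upper_cone f) q' = Some d \<and> d \<in> app (upper_cone f) x"
      using q(1) y(2) by (auto simp: map_comp_def upper_cone_def degrees_def)
  qed
qed

text \<open>The instances of \<open>f\<close> of all the given instances of \<open>\<Pi>f\<close> are merged into one, so that
  the solution below \<open>q\<close> found by the \<open>n\<close>-th program contains a solution of the \<open>n\<close>-th instance.\<close>

lemma stashing_parallelization_le_upper_cone:
  "stashing (parallelization f) \<le>\<^sub>s\<^sub>W upper_cone (parallelization f)"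
  unfolding sW_le_def
proof (intro exI conjI allI impI)
  \<comment> \<open>Entry \<open>m\<close> of the merged instance is entry \<open>csnd m\<close> of
    instance \<open>cfst m\<close>; \<open>K\<close> only rearranges the name.\<close>
  define K where "K = (\<lambda>p :: baire. Some (\<lambda>x. p (cpair (cfst (cfst x)) (cpair (csnd (cfst x)) (csnd x)))))"
  show "computable (\<lambda>p. Some (emit p))"
    by (intro computable_total computes_emit)
  show "computable K"
    unfolding K_def by (intro computable_total computes_intros)
  fix G
  assume G: "realizer G (upper_cone (parallelization f))"
  show "realizer ((\<lambda>p. Some (emit p)) \<circ>\<^sub>m G \<circ>\<^sub>m K) (stashing (parallelization f))"
    unfolding realizer_def
  proof (intro allI impI)
    fix p x
    assume "src (stashing (parallelization f)) p = Some x \<and> x \<in> pdom (stashing (parallelization f))"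
    then have p: "\<And>n i. src f (component (component p n) i) = Some (x n i)"
      and x: "\<And>n i. x n i \<in> pdom f"
      by (auto simp: stashing_def parallelization_def seq_space_eq_Some_iff)
    obtain p' where p': "K p = Some p'" by (simp add: K_def)
    then have "component p' m = component (component p (cfst m)) (csnd m)" for m
      by (auto simp: K_def component_def)
    then have "seq_space (src f) p' = Some (\<lambda>m. x (cfst m) (csnd m))"
      by (simp add: seq_space_eq_Some_iff p)
    then obtain q d where q: "G p' = Some q" "degrees q = Some d"
      and "d \<in> app (upper_cone (parallelization f)) (\<lambda>m. x (cfst m) (csnd m))"
      using G x unfolding realizer_def upper_cone_def parallelization_def by fastforce
    then obtain q' y where q': "turing_degree q = turing_degree q'"
      and y': "point_turing_le (seq_space (tgt f)) y q'" and y: "\<And>m. y m \<in> app f (x (cfst m) (csnd m))"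
      by (auto simp: upper_cone_def parallelization_def degrees_def)
    obtain r where r: "\<And>m. tgt f (component r m) = Some (y m)" and "r \<le>\<^sub>T q'"
      using y' by (auto simp: point_turing_le_def seq_space_eq_Some_iff)
    \<comment> \<open>The cone witness \<open>q'\<close> may differ from the answer
      \<open>q\<close>, but both have the same degree.\<close>
    moreover have "q' \<le>\<^sub>T q"
      using q' turing_le_refl by (auto simp: turing_degree_def turing_eq_def set_eq_iff)
    ultimately have "r \<le>\<^sub>T q"
      using turing_le_trans by blast
    \<comment> \<open>Regrouping makes component \<open>n\<close> of \<open>s\<close> a name of a
      solution of instance \<open>n\<close>; a program for \<open>s\<close> then serves the block
      carrying its own number.\<close>
    define s where "s = (\<lambda>z. r (cpair (cpair (cfst z) (cfst (csnd z))) (csnd (csnd z))))"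
    have "computes {r} (\<lambda>r z. r (cpair (cpair (cfst z) (cfst (csnd z))) (csnd (csnd z))))"
      by (intro computes_intros)
    then have "s \<le>\<^sub>T r"
      unfolding s_def by (rule computes_imp_turing_le)
    then obtain n where n: "minus_one (component (emit q) n) = Some (component s n)"
      using minus_one_component_emit turing_le_trans [OF _ \<open>r \<le>\<^sub>T q\<close>] by blast
    have "component (component s n) i = component r (cpair n i)" for i
      by (simp add: component_def s_def)
    then have "seq_space (tgt f) (component s n) = Some (\<lambda>i. y (cpair n i))"
      by (simp add: seq_space_eq_Some_iff r)
    with n have "completion (seq_space (tgt f)) (component (emit q) n) = Some (Some (\<lambda>i. y (cpair n i)))"
      by (simp add: completion_eq_Some_Some_iff)
    \<comment> \<open>Completions have total representations, so \<open>emit q\<close> is a name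
      whatever the other programs write.\<close>
    moreover obtain z where z: "seq_space (completion (seq_space (tgt f))) (emit q) = Some z"
      by (simp add: seq_space_def completion_def dom_def)
    ultimately have "z n = Some (\<lambda>i. y (cpair n i))"
      by (simp add: seq_space_eq_Some_iff)
    moreover have "y (cpair n i) \<in> app f (x n i)" for i
      using y [of "cpair n i"] by simp
    ultimately have "z \<in> app (stashing (parallelization f)) x"
      using z by (auto simp: stashing_def parallelization_def intro: ranI)
    then show "\<exists>q z. ((\<lambda>p. Some (emit p)) \<circ>\<^sub>m G \<circ>\<^sub>m K) p = Some q \<and>
        tgt (stashing (parallelization f)) q = Some z \<and> z \<in> app (stashing (parallelization f)) x"
      using z q(1) p' by (auto simp: map_comp_def stashing_def parallelization_def)
  qed
qed

theorem proposition1p15: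
  fixes f :: "('a, 'b) problem"
  assumes "is_problem f"
  shows "stashing (parallelization f) \<equiv>\<^sub>s\<^sub>W upper_cone (parallelization f)"
  unfolding sW_eq_def
  by (intro conjI stashing_parallelization_le_upper_cone upper_cone_le_stashing)

end
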